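(* Let $k \leq n$ be positive integers and let $\lambda = (\lambda_1 \geq \cdots \geq \lambda_s\ge 0)$ be a partition of $k$ with $s$ parts. The map $\mathtt{code}: \mathcal{OP}_{n,\lambda} \to \mathcal{C}_{n,\lambda}$, $\sigma\mapsto\mathtt{code}(\sigma)$, is a well-defined bijection.
   Context: A partition of $k$ with $s$ parts is a weakly decreasing sequence of $s$ nonnegative integers (trailing zeros allowed) summing to $k$; $\lambda'$ is its conjugate ($\lambda'_j=\#\{i:\lambda_i\ge j\}$). $\mathcal{OP}_{n,\lambda}$ is the set of sequences $\sigma=(B_1\mid\cdots\mid B_s)$ of (possibly empty) subsets of $[n]$ with $[n]=B_1\sqcup\cdots\sqcup B_s$ and $|B_i|\ge\lambda_i$. Container diagram: column $i$ has $\lambda_i$ top-justified boxes (rows numbered from the top); the box in row $j$ ($1\le j\le \lambda_i$) of column $i$ holds the $(\lambda_i-j+1)$-th smallest element of $B_i$; the other $|B_i|-\lambda_i$ (largest) elements of $B_i$ are floating in block $i$. "To the right/left" refers to block indices. For $1\le i<j\le n$, $(i,j)$ is a coinversion of $\sigma$ if: (a) $i$ is floating, $j$ is in a block to the right of $i$, and $j$ is in the top row of the container; or (b) $i$ is not floating, $j$ is in a block to the right of $i$, and $i,j$ are in the same container row; or (c) $i$ is not floating, $j$ is in a block to the left of $i$, and $j$ is in the container row directly below that of $i$. Let $c_i$ be the number of $j>i$ with $(i,j)$ a coinversion, plus $p-1$ if $i$ is floating in block $p$; $\mathtt{code}(\sigma)=(c_1,\dots,c_n)$. $\mathcal{C}_{n,\lambda}$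 is the set of length-$n$ sequences of nonnegative integers that are componentwise $\le$ some shuffle (order-preserving interleaving) of the sequences $(\lambda'_j-1,\dots,1,0)$ for $j=1,\dots,k$ (empty when $\lambda'_j=0$) and the constant sequence $(s-1,\dots,s-1)$ of length $n-k$. *)

theory Defs
  imports Main
begin

(* A partition of k with s parts is the list of its s parts, trailing zeros kept. *)

definition is_partition :: "nat \<Rightarrow> nat \<Rightarrow> nat list \<Rightarrow> bool" where
  "is_partition k s lam \<longleftrightarrow> length lam = s \<and> sorted_wrt (\<ge>) lam \<and> sum_list lam = k"

definition conj_part :: "nat list \<Rightarrow> nat \<Rightarrow> nat" where
  "conj_part lam j = card {i. i < length lam \<and> j \<le> lam ! i}"

(* Elements of the ground set and container rows are numbered from 1. Blocks are stored in a
   list and numbered from 0, so B_p of the text is sigma ! (p - 1). *)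

definition OP :: "nat \<Rightarrow> nat list \<Rightarrow> nat set list set" where
  "OP n lam = {sigma. length sigma = length lam
     \<and> (\<Union>p<length sigma. sigma ! p) = {1..n}
     \<and> (\<forall>p<length sigma. \<forall>q<length sigma. p \<noteq> q \<longrightarrow> sigma ! p \<inter> sigma ! q = {})
     \<and> (\<forall>p<length sigma. lam ! p \<le> card (sigma ! p))}"

definition block_of :: "nat set list \<Rightarrow> nat \<Rightarrow> nat" where
  "block_of sigma x = (THE p. p < length sigma \<and> x \<in> sigma ! p)"

(* The box in row r of column p holds the (lam ! p - r + 1)-th smallest element of the block,
   which has 0-based index lam ! p - r in the increasing enumeration. *)

definition box_entry :: "nat list \<Rightarrow> nat set list \<Rightarrow> nat \<Rightarrow> nat \<Rightarrow> nat" where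
  "box_entry lam sigma p r = sorted_list_of_set (sigma ! p) ! (lam ! p - r)"

definition in_row :: "nat list \<Rightarrow> nat set list \<Rightarrow> nat \<Rightarrow> nat \<Rightarrow> bool" where
  "in_row lam sigma r x \<longleftrightarrow>
     (\<exists>p<length sigma. 1 \<le> r \<and> r \<le> lam ! p \<and> x = box_entry lam sigma p r)"

definition floating :: "nat list \<Rightarrow> nat set list \<Rightarrow> nat \<Rightarrow> bool" where
  "floating lam sigma x \<longleftrightarrow>
     (\<exists>p<length sigma. x \<in> sigma ! p) \<and> \<not> (\<exists>r. in_row lam sigma r x)"

definition coinversion :: "nat list \<Rightarrow> nat set list \<Rightarrow> nat \<Rightarrow> nat \<Rightarrow> bool" where
  "coinversion lam sigma i j \<longleftrightarrow> i < j \<and>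
     ((floating lam sigma i \<and> block_of sigma i < block_of sigma j \<and> in_row lam sigma 1 j)
      \<or> (\<exists>r. in_row lam sigma r i \<and> in_row lam sigma r j \<and> block_of sigma i < block_of sigma j)
      \<or> (\<exists>r. in_row lam sigma r i \<and> in_row lam sigma (r + 1) j \<and> block_of sigma j < block_of sigma i))"

(* The contribution p - 1 of a floating element of block p is its 0-based block index. *)

definition code_entry :: "nat \<Rightarrow> nat list \<Rightarrow> nat set list \<Rightarrow> nat \<Rightarrow> nat" where
  "code_entry n lam sigma i = card {j \<in> {1..n}. coinversion lam sigma i j}
     + (if floating lam sigma i then block_of sigma i else 0)"

definition coinv_code :: "nat \<Rightarrow> nat list \<Rightarrow> nat set list \<Rightarrow> nat list" where
  "coinv_code n lam sigma = map (code_entry n lam sigma) [1..<n + 1]"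

fun multi_shuffles :: "'a list list \<Rightarrow> 'a list set" where
  "multi_shuffles [] = {[]}"
| "multi_shuffles (xs # xss) = (\<Union>ys\<in>multi_shuffles xss. shuffles xs ys)"

definition code_shuffles :: "nat \<Rightarrow> nat list \<Rightarrow> nat list set" where
  "code_shuffles n lam = (let k = sum_list lam; s = length lam in
     multi_shuffles (map (\<lambda>j. rev [0..<conj_part lam j]) [1..<k + 1] @ [replicate (n - k) (s - 1)]))"

definition C_seqs :: "nat \<Rightarrow> nat list \<Rightarrow> nat list set" where
  "C_seqs n lam = {c. length c = n \<and> (\<exists>w\<in>code_shuffles n lam. list_all2 (\<le>) c w)}"

end

theory Submission
  imports Defs "HOL-Library.Multiset"
begin

text \<open>
  Induction on the ground set, removing its smallest element \<open>m\<close>. The code entry of \<open>m\<close> is the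
  rank of its block in a total order on blocks that depends only on \<open>\<lambda>\<close>, so it determines the
  block, and deleting \<open>m\<close> while lowering that part of \<open>\<lambda>\<close> by one (truncated at 0) leaves all other
  code entries unchanged. The parts of \<open>\<lambda>\<close> must therefore be allowed in any order. On the side of
  shuffles, an exchange argument shows that the first entry \<open>x\<close> may always be matched greedily,
  with the shortest column of height greater than \<open>x\<close>, and with the constant sequence only if there
  is no such column. If \<open>x\<close> is the rank of block \<open>p\<close> and \<open>\<lambda>\<^sub>p > 0\<close>, this is column \<open>\<lambda>\<^sub>p\<close>, so both sides
  obey the same recursion.
\<close>

section \<open>Domination by a shuffle as a recursion on multisets\<close>

text \<open>
  \<open>M\<close> holds the numbers of entries left in the decreasing sequences \<open>(v - 1, \<dots>, 1, 0)\<close>, and \<open>N\<close> is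
  the number of entries \<open>t = s - 1\<close> left in the constant sequence.
\<close>

fun dominated :: "nat \<Rightarrow> nat list \<Rightarrow> nat multiset \<Rightarrow> nat \<Rightarrow> bool" where
  "dominated t [] M N \<longleftrightarrow> (\<forall>v\<in>#M. v = 0) \<and> N = 0"
| "dominated t (x # c) M N \<longleftrightarrow>
     (\<exists>v R. M = add_mset (Suc v) R \<and> x \<le> v \<and> dominated t c (add_mset v R) N)
     \<or> (\<exists>N'. N = Suc N' \<and> x \<le> t \<and> dominated t c M N')"

text \<open>The head of a shuffle comes from some constituent, and the tail is a shuffle in which
  that constituent has lost its head. Shortening it in place keeps the indexing, so the step can be
  iterated.\<close>

lemma Cons_in_multi_shuffles_iff:
  "x # w \<in> multi_shuffles xss \<longleftrightarrow>
     (\<exists>i<length xss. \<exists>t. xss ! i = x # t \<and> w \<in> multi_shuffles (xss[i := t]))"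
proof (induction xss arbitrary: w)
  case Nil
  then show ?case by simp
next
  case (Cons xs xss)
  have "x # w \<in> shuffles xs ys \<longleftrightarrow>
     (\<exists>t. xs = x # t \<and> w \<in> shuffles t ys) \<or> (\<exists>u. ys = x # u \<and> w \<in> shuffles xs u)" for ys
    by (cases xs; cases ys) (auto simp: Cons_in_shuffles_iff)
  then have "x # w \<in> multi_shuffles (xs # xss) \<longleftrightarrow>
     (\<exists>ys\<in>multi_shuffles xss. \<exists>t. xs = x # t \<and> w \<in> shuffles t ys)
     \<or> (\<exists>ys. x # ys \<in> multi_shuffles xss \<and> w \<in> shuffles xs ys)"
    unfolding multi_shuffles.simps UN_iff by blast
  also have "\<dots> \<longleftrightarrow> (\<exists>t. xs = x # t \<and> w \<in> multi_shuffles (t # xss))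
     \<or> (\<exists>i<length xss. \<exists>t. xss ! i = x # t \<and> w \<in> multi_shuffles (xs # xss[i := t]))"
    unfolding multi_shuffles.simps UN_iff Cons.IH by blast
  also have "\<dots> \<longleftrightarrow> (\<exists>i<length (xs # xss). \<exists>t. (xs # xss) ! i = x # t
      \<and> w \<in> multi_shuffles ((xs # xss)[i := t]))"
    unfolding length_Cons Ex_less_Suc2 by simp
  finally show ?case .
qed

lemma Nil_in_multi_shuffles_iff: "[] \<in> multi_shuffles xss \<longleftrightarrow> (\<forall>xs\<in>set xss. xs = [])"
  by (induction xss) (auto simp: Nil_in_shuffles)

text \<open>Since \<open>rev [0..<Suc v] = v # rev [0..<v]\<close>, a used sequence keeps its shape,
  so its length is all that matters.\<close>

lemma multi_shuffles_dominated_iff: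
  "(\<exists>w\<in>multi_shuffles (map (\<lambda>h. rev [0..<h]) hs @ [replicate N t]). list_all2 (\<le>) c w)
     \<longleftrightarrow> dominated t c (mset hs) N"
proof (induction c arbitrary: hs N)
  case Nil
  show ?case by (auto simp: Nil_in_multi_shuffles_iff)
next
  case (Cons x c)
  let ?D = "\<lambda>hs N. \<exists>w\<in>multi_shuffles (map (\<lambda>h. rev [0..<h]) hs @ [replicate N t]). list_all2 (\<le>) c w"
  let ?X = "map (\<lambda>h. rev [0..<h]) hs @ [replicate N t]"
  have "(\<exists>w\<in>multi_shuffles ?X. list_all2 (\<le>) (x # c) w) \<longleftrightarrow>
     (\<exists>i<length ?X. \<exists>y u. ?X ! i = y # u \<and> x \<le> y
        \<and> (\<exists>w\<in>multi_shuffles (?X[i := u]). list_all2 (\<le>) c w))"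
    unfolding list_all2_Cons1 Bex_def
    using Cons_in_multi_shuffles_iff[of _ _ ?X] by blast
  also have "\<dots> \<longleftrightarrow>
     (\<exists>i<length hs. \<exists>y u. rev [0..<hs ! i] = y # u \<and> x \<le> y
        \<and> (\<exists>w\<in>multi_shuffles ((map (\<lambda>h. rev [0..<h]) hs)[i := u] @ [replicate N t]). list_all2 (\<le>) c w))
     \<or> (\<exists>y u. replicate N t = y # u \<and> x \<le> y
        \<and> (\<exists>w\<in>multi_shuffles (map (\<lambda>h. rev [0..<h]) hs @ [u]). list_all2 (\<le>) c w))"
  proof -
    \<comment> \<open>Index \<open>length hs\<close> is the constant sequence, the smaller ones are
      the decreasing sequences.\<close>
    have split: "(\<exists>i<length ?X. P i) \<longleftrightarrow> (\<exists>i<length hs. P i) \<or> P (length hs)" for P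
      by (auto simp: less_Suc_eq)
    show ?thesis
      unfolding split by (simp add: nth_append list_update_append cong: conj_cong)
  qed
  also have "(\<exists>y u. replicate N t = y # u \<and> x \<le> y
        \<and> (\<exists>w\<in>multi_shuffles (map (\<lambda>h. rev [0..<h]) hs @ [u]). list_all2 (\<le>) c w))
      \<longleftrightarrow> (\<exists>N'. N = Suc N' \<and> x \<le> t \<and> ?D hs N')"
    by (cases N) simp_all
  also have "(\<exists>i<length hs. \<exists>y u. rev [0..<hs ! i] = y # u \<and> x \<le> y
        \<and> (\<exists>w\<in>multi_shuffles ((map (\<lambda>h. rev [0..<h]) hs)[i := u] @ [replicate N t]). list_all2 (\<le>) c w))
      \<longleftrightarrow> (\<exists>i<length hs. \<exists>v. hs ! i = Suc v \<and> x \<le> v \<and> ?D (hs[i := v]) N)"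
  proof -
    have "rev [0..<h] = y # u \<longleftrightarrow> h = Suc y \<and> u = rev [0..<y]" for h y u
      by (cases h) auto
    then show ?thesis by (simp add: map_update)
  qed
  also have "\<dots> \<longleftrightarrow> (\<exists>v R. mset hs = add_mset (Suc v) R \<and> x \<le> v \<and> dominated t c (add_mset v R) N)"
  proof
    assume "\<exists>i<length hs. \<exists>v. hs ! i = Suc v \<and> x \<le> v \<and> ?D (hs[i := v]) N"
    then obtain i v where i: "i < length hs" "hs ! i = Suc v" "x \<le> v" "dominated t c (mset (hs[i := v])) N"
      unfolding Cons.IH by blast
    show "\<exists>v R. mset hs = add_mset (Suc v) R \<and> x \<le> v \<and> dominated t c (add_mset v R) N"
    proof (intro exI conjI)
      show "mset hs = add_mset (Suc v) (mset hs - {#Suc v#})"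
        using i(1,2) by (metis insert_DiffM nth_mem_mset)
      show "dominated t c (add_mset v (mset hs - {#Suc v#})) N"
        using i by (simp add: mset_update)
    qed fact
  next
    assume "\<exists>v R. mset hs = add_mset (Suc v) R \<and> x \<le> v \<and> dominated t c (add_mset v R) N"
    then obtain v R where v: "mset hs = add_mset (Suc v) R" "x \<le> v" "dominated t c (add_mset v R) N"
      by blast
    \<comment> \<open>The multiset forgets positions, so any position holding \<open>Suc v\<close>
      may be shortened.\<close>
    then have "Suc v \<in> set hs" by (metis set_mset_mset union_single_eq_member)
    then obtain i where i: "i < length hs" "hs ! i = Suc v" by (metis in_set_conv_nth)
    with v have "mset (hs[i := v]) = add_mset v R" by (simp add: mset_update)
    with v i show "\<exists>i<length hs. \<exists>v. hs ! i = Suc v \<and> x \<le> v \<and> ?D (hs[i := v]) N"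
      unfolding Cons.IH by metis
  qed
  finally show ?case unfolding Cons.IH by simp
qed

section \<open>Exchange arguments and greedy matching\<close>

text \<open>
  The same choices are made in both states until the column of height \<open>Suc v\<close> is used, where its
  entry is taken from the column of height \<open>Suc u\<close> instead and the states merge, or until \<open>u = v\<close>.
\<close>

lemma dominated_exchange:
  assumes "dominated t c (add_mset u (add_mset (Suc v) M)) N" "v \<le> u"
  shows "dominated t c (add_mset (Suc u) (add_mset v M)) N"
  using assms
proof (induction c arbitrary: u M N)
  case Nil
  then show ?case by simp
next
  case (Cons x c)
  show ?case
  proof (cases "u = v")
    case True
    with Cons.prems(1) show ?thesis by (simp add: add_mset_commute)
  next
    case False
    with Cons.prems(2) have vu: "v < u" by simp
    from Cons.prems(1) consider
      (column) w R where "add_mset u (add_mset (Suc v) M) = add_mset (Suc w) R" "x \<le> w"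
        "dominated t c (add_mset w R) N"
      | (const) N' where "N = Suc N'" "x \<le> t" "dominated t c (add_mset u (add_mset (Suc v) M)) N'"
      by auto
    then show ?thesis
    proof cases
      case column
      from column(1) consider (u) "Suc w = u" "R = add_mset (Suc v) M"
        | (v) "w = v" "R = add_mset u M"
        | (M) M' where "M = add_mset (Suc w) M'" "R = add_mset u (add_mset (Suc v) M')"
        unfolding add_eq_conv_ex by blast
      then show ?thesis
      proof cases
        \<comment> \<open>The column of height \<open>Suc u\<close> stands in for the one of height
          \<open>u\<close>; the exchange goes on with \<open>w = u - 1\<close>, still at least
          \<open>v\<close>.\<close>
        case u
        with column vu have "dominated t c (add_mset (Suc w) (add_mset v M)) N"
          by (intro Cons.IH) auto
        with u column show ?thesis by (auto intro!: exI[of _ u] exI[of _ "add_mset v M"])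
      next
        case v
        with column vu show ?thesis
          by (auto simp: add_mset_commute intro!: exI[of _ u] exI[of _ "add_mset v M"])
      next
        case M
        have "dominated t c (add_mset (Suc u) (add_mset v (add_mset w M'))) N"
          using column M vu by (intro Cons.IH) (auto simp: add_mset_commute)
        with M column show ?thesis
          by (auto simp: add_mset_commute
              intro!: exI[of _ w] exI[of _ "add_mset (Suc u) (add_mset v M')"])
      qed
    next
      case const
      with Cons.IH[OF const(3)] vu show ?thesis by simp
    qed
  qed
qed

text \<open>All choices are copied until the entry \<open>v\<close> is used; its letter is then
  matched with the additional constant entry \<open>t \<ge> v\<close>, and the states merge.\<close>

lemma dominated_exchange_const:
  assumes "dominated t c (add_mset (Suc v) M) N" "v \<le> t"
  shows "dominated t c (add_mset v M) (Suc N)"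
  using assms
proof (induction c arbitrary: M N)
  case Nil
  then show ?case by simp
next
  case (Cons x c)
  from Cons.prems(1) consider
    (column) w R where "add_mset (Suc v) M = add_mset (Suc w) R" "x \<le> w"
      "dominated t c (add_mset w R) N"
    | (const) N' where "N = Suc N'" "x \<le> t" "dominated t c (add_mset (Suc v) M) N'"
    by auto
  then show ?case
  proof cases
    case column
    from column(1) consider (v) "w = v" "R = M"
      | (M) M' where "M = add_mset (Suc w) M'" "R = add_mset (Suc v) M'"
      unfolding add_eq_conv_ex by blast
    then show ?thesis
    proof cases
      case v
      with column Cons.prems(2) show ?thesis by auto
    next
      case M
      have "dominated t c (add_mset v (add_mset w M')) (Suc N)"
        using column M Cons.prems by (intro Cons.IH) (auto simp: add_mset_commute)
      with M column show ?thesis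
        by (auto simp: add_mset_commute intro!: exI[of _ w] exI[of _ "add_mset v M'"])
    qed
  next
    case const
    with Cons.IH[OF const(3)] Cons.prems(2) show ?thesis by simp
  qed
qed

text \<open>The exchange lemmas turn any other first choice into this one: by \<open>least\<close>
  no usable column is shorter than \<open>Suc v\<close>, and \<open>v \<le> t\<close> makes a
  constant entry the last resort.\<close>

lemma dominated_Cons_greedy:
  assumes x: "x \<le> v" and vt: "v \<le> t" and least: "\<And>u. u \<in># R \<Longrightarrow> x < u \<Longrightarrow> v < u"
  shows "dominated t (x # c) (add_mset (Suc v) R) N \<longleftrightarrow> dominated t c (add_mset v R) N"
proof
  assume "dominated t (x # c) (add_mset (Suc v) R) N"
  then consider
    (column) w Q where "add_mset (Suc v) R = add_mset (Suc w) Q" "x \<le> w"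
      "dominated t c (add_mset w Q) N"
    | (const) N' where "N = Suc N'" "x \<le> t" "dominated t c (add_mset (Suc v) R) N'"
    by auto
  then show "dominated t c (add_mset v R) N"
  proof cases
    case column
    from column(1) consider (v) "w = v" "Q = R"
      | (R) R' where "R = add_mset (Suc w) R'" "Q = add_mset (Suc v) R'"
      unfolding add_eq_conv_ex by blast
    then show ?thesis
    proof cases
      case v
      with column show ?thesis by simp
    next
      case R
      with least[of "Suc w"] column have "v \<le> w" by auto
      with dominated_exchange[of t c w v R' N] column R show ?thesis
        by (simp add: add_mset_commute)
    qed
  next
    case const
    with dominated_exchange_const vt show ?thesis by simp
  qed
next
  assume "dominated t c (add_mset v R) N"
  with x show "dominated t (x # c) (add_mset (Suc v) R) N" by auto
qed

section \<open>Ranking the blocks\<close>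

text \<open>
  The tie-breaking reflects that the smallest element of a block \<open>p\<close> sits at the bottom of its
  column, and so sees the columns of the same height on its right, unless \<open>lam ! p = 0\<close>: then it
  floats and contributes the number of all blocks on its left.
\<close>

definition precedes :: "nat list \<Rightarrow> nat \<Rightarrow> nat \<Rightarrow> bool" where
  "precedes lam q p \<longleftrightarrow> lam ! p < lam ! q
     \<or> lam ! p = lam ! q \<and> (if lam ! p = 0 then q < p else p < q)"

definition block_rank :: "nat list \<Rightarrow> nat \<Rightarrow> nat" where
  "block_rank lam p = card {q. q < length lam \<and> precedes lam q p}"

lemma block_rank_strict:
  assumes "precedes lam q p" "q < length lam"
  shows "block_rank lam q < block_rank lam p"
  unfolding block_rank_def
proof (rule psubset_card_mono)
  show "{r. r < length lam \<and> precedes lam r q} \<subset> {r. r < length lam \<and> precedes lam r p}"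
  proof (intro psubsetI subsetI)
    fix r assume "r \<in> {r. r < length lam \<and> precedes lam r q}"
    with assms(1) show "r \<in> {r. r < length lam \<and> precedes lam r p}"
      by (auto simp: precedes_def split: if_splits)
  next
    have "\<not> precedes lam q q" by (simp add: precedes_def)
    with assms show "{r. r < length lam \<and> precedes lam r q} \<noteq> {r. r < length lam \<and> precedes lam r p}"
      by blast
  qed
qed simp

text \<open>All strictly taller columns precede \<open>p\<close>, and whatever precedes
  \<open>p\<close> is another column at least as tall. This bound and the next place the rank
  between the lengths of the container rows \<open>Suc (lam ! p)\<close> and \<open>lam ! p\<close>,
  which singles out the greedy choice.\<close>

lemma conj_part_Suc_le_block_rank: "conj_part lam (Suc (lam ! p)) \<le> block_rank lam p"
  unfolding conj_part_def block_rank_def by (rule card_mono) (auto simp: precedes_def)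

lemma block_rank_less_conj_part:
  assumes "p < length lam"
  shows "block_rank lam p < conj_part lam (lam ! p)"
  unfolding conj_part_def block_rank_def
proof (rule psubset_card_mono)
  have "p \<in> {i. i < length lam \<and> lam ! p \<le> lam ! i}" "\<not> precedes lam p p"
    using assms by (auto simp: precedes_def)
  moreover have "lam ! p \<le> lam ! q" if "precedes lam q p" for q
    using that by (auto simp: precedes_def)
  ultimately show "{q. q < length lam \<and> precedes lam q p} \<subset> {i. i < length lam \<and> lam ! p \<le> lam ! i}"
    by blast
qed simp

lemma conj_part_le_length: "conj_part lam j \<le> length lam"
proof -
  have "conj_part lam j \<le> card {..<length lam}"
    unfolding conj_part_def by (rule card_mono) auto
  then show ?thesis by simp
qed

lemma conj_part_antimono: "i \<le> j \<Longrightarrow> conj_part lam j \<le> conj_part lam i"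
  unfolding conj_part_def by (rule card_mono) auto

lemma inj_on_block_rank: "inj_on (block_rank lam) {..<length lam}"
proof (rule inj_onI)
  fix p q assume "p \<in> {..<length lam}" "q \<in> {..<length lam}" "block_rank lam p = block_rank lam q"
  then have "\<not> precedes lam p q" "\<not> precedes lam q p"
    using block_rank_strict by fastforce+
  then show "p = q" by (auto simp: precedes_def split: if_splits)
qed

lemma bij_betw_block_rank: "bij_betw (block_rank lam) {..<length lam} {..<length lam}"
proof -
  have "block_rank lam ` {..<length lam} \<subseteq> {..<length lam}"
    using block_rank_less_conj_part conj_part_le_length by (fastforce intro: less_le_trans)
  then have "block_rank lam ` {..<length lam} = {..<length lam}"
    using inj_on_block_rank by (intro endo_inj_surj) auto
  with inj_on_block_rank show ?thesis by (simp add: bij_betw_def)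
qed

section \<open>Lowering a part and the conjugate\<close>

definition decrement :: "nat list \<Rightarrow> nat \<Rightarrow> nat list" where
  "decrement lam p = lam[p := lam ! p - 1]"

text \<open>The bound \<open>K\<close> is independent of \<open>lam\<close> so that it can stay fixed while parts are decremented.\<close>

definition conj_mset :: "nat \<Rightarrow> nat list \<Rightarrow> nat multiset" where
  "conj_mset K lam = image_mset (conj_part lam) (mset_set {1..K})"

text \<open>Column \<open>p\<close> loses its bottom box, which lies in row
  \<open>Suc a\<close>.\<close>

lemma conj_part_decrement:
  assumes "p < length lam" "lam ! p = Suc a"
  shows "conj_part (decrement lam p) j =
    (if j = Suc a then conj_part lam j - 1 else conj_part lam j)"
proof (cases "j = Suc a")
  case True
  have "{i. i < length lam \<and> j \<le> decrement lam p ! i} = {i. i < length lam \<and> j \<le> lam ! i} - {p}"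
    using assms True by (auto simp: decrement_def nth_list_update)
  with assms True show ?thesis by (simp add: conj_part_def decrement_def)
next
  case False
  have "{i. i < length lam \<and> j \<le> decrement lam p ! i} = {i. i < length lam \<and> j \<le> lam ! i}"
    using assms False by (auto simp: decrement_def nth_list_update)
  with False show ?thesis by (simp add: conj_part_def decrement_def)
qed

text \<open>The common remainder \<open>R\<close> brings both multisets into the form of the greedy
  step.\<close>

lemma conj_mset_decrement:
  assumes p: "p < length lam" "lam ! p = Suc a" "Suc a \<le> K"
  defines "R \<equiv> image_mset (conj_part lam) (mset_set ({1..K} - {Suc a}))"
  shows "conj_mset K lam = add_mset (conj_part lam (Suc a)) R"
    and "conj_mset K (decrement lam p) = add_mset (conj_part lam (Suc a) - 1) R"
proof -
  have K: "mset_set {1..K} = add_mset (Suc a) (mset_set ({1..K} - {Suc a}))"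
    using p by (subst mset_set.remove[of _ "Suc a"]) auto
  show "conj_mset K lam = add_mset (conj_part lam (Suc a)) R"
    unfolding conj_mset_def R_def K by simp
  have "image_mset (conj_part (decrement lam p)) (mset_set ({1..K} - {Suc a})) = R"
    unfolding R_def by (rule image_mset_cong) (auto simp: conj_part_decrement[OF p(1,2)])
  then show "conj_mset K (decrement lam p) = add_mset (conj_part lam (Suc a) - 1) R"
    unfolding conj_mset_def K using conj_part_decrement[OF p(1,2), of "Suc a"] by simp
qed

lemma dominated_Cons_positive:
  assumes p: "p < length lam" "lam ! p = Suc a" "Suc a \<le> K" and t: "length lam = Suc t"
  shows "dominated t (block_rank lam p # c) (conj_mset K lam) N
    \<longleftrightarrow> dominated t c (conj_mset K (decrement lam p)) N"
proof -
  let ?x = "block_rank lam p" and ?h = "conj_part lam (Suc a)"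
  have lt: "?x < ?h" using block_rank_less_conj_part[OF p(1)] p by simp
  \<comment> \<open>\<open>Suc (?h - 1)\<close> is \<open>?h\<close>, positive by \<open>lt\<close>,
    in the form the greedy lemma expects.\<close>
  have "dominated t (?x # c) (add_mset (Suc (?h - 1)) (image_mset (conj_part lam) (mset_set ({1..K} - {Suc a})))) N
    \<longleftrightarrow> dominated t c (add_mset (?h - 1) (image_mset (conj_part lam) (mset_set ({1..K} - {Suc a})))) N"
  proof (rule dominated_Cons_greedy)
    show "?x \<le> ?h - 1" using lt by simp
    show "?h - 1 \<le> t" using conj_part_le_length[of lam "Suc a"] t by simp
    fix u assume "u \<in># image_mset (conj_part lam) (mset_set ({1..K} - {Suc a}))" and xu: "?x < u"
    then obtain j where u: "u = conj_part lam j" by auto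
    \<comment> \<open>Rows below row \<open>Suc a\<close> are no longer than the rank, hence
      unusable; the others are at least as long as row \<open>Suc a\<close>.\<close>
    have "j \<le> Suc a"
    proof (rule ccontr)
      assume "\<not> j \<le> Suc a"
      then have "u \<le> conj_part lam (Suc (Suc a))" unfolding u by (intro conj_part_antimono) simp
      also have "\<dots> \<le> ?x" using conj_part_Suc_le_block_rank[of lam p] p by simp
      finally show False using xu by simp
    qed
    then have "?h \<le> u" unfolding u by (rule conj_part_antimono)
    with lt show "?h - 1 < u" by simp
  qed
  with lt show ?thesis by (simp add: conj_mset_decrement[OF p])
qed

text \<open>For \<open>lam ! p = 0\<close> the rank is at least the length of the top row, the
  longest one, so only a constant entry can match it.\<close>

lemma dominated_Cons_zero:
  assumes p: "p < length lam" "lam ! p = 0" and t: "length lam = Suc t"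
  shows "dominated t (block_rank lam p # c) (conj_mset K lam) N
    \<longleftrightarrow> (\<exists>N'. N = Suc N' \<and> dominated t c (conj_mset K lam) N')"
proof -
  let ?x = "block_rank lam p"
  have "u \<le> ?x" if "u \<in># conj_mset K lam" for u
  proof -
    obtain j where j: "1 \<le> j" "u = conj_part lam j" using \<open>u \<in># conj_mset K lam\<close> by (auto simp: conj_mset_def)
    have "u \<le> conj_part lam 1" unfolding j(2) using j(1) by (rule conj_part_antimono)
    also have "\<dots> \<le> ?x" using conj_part_Suc_le_block_rank[of lam p] p by simp
    finally show ?thesis .
  qed
  then have "\<not> (\<exists>v R. conj_mset K lam = add_mset (Suc v) R \<and> ?x \<le> v)"
    by (metis not_less_eq_eq union_single_eq_member)
  moreover have "?x \<le> t"
    using block_rank_less_conj_part[OF p(1)] conj_part_le_length[of lam "lam ! p"] t by simp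
  ultimately show ?thesis by auto
qed

text \<open>Rows have at most \<open>length lam\<close> boxes, so no available entry exceeds
  \<open>t\<close>.\<close>

lemma dominated_Cons_imp_less:
  assumes "dominated t (x # c) (conj_mset K lam) N" "length lam = Suc t"
  shows "x < length lam"
proof -
  have "u \<le> Suc t" if "u \<in># conj_mset K lam" for u
    using that assms(2) conj_part_le_length[of lam] by (auto simp: conj_mset_def)
  then have "x \<le> t" using assms(1) by fastforce
  with assms(2) show ?thesis by simp
qed

section \<open>Container diagrams\<close>

text \<open>Removing smallest elements leaves ground sets \<open>{m..n}\<close>, empty once
  \<open>m > n\<close>.\<close>

definition OP_from :: "nat \<Rightarrow> nat \<Rightarrow> nat list \<Rightarrow> nat set list set" where
  "OP_from m n lam = {sigma. length sigma = length lam
     \<and> (\<Union>p<length sigma. sigma ! p) = {m..n}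
     \<and> (\<forall>p<length sigma. \<forall>q<length sigma. p \<noteq> q \<longrightarrow> sigma ! p \<inter> sigma ! q = {})
     \<and> (\<forall>p<length sigma. lam ! p \<le> card (sigma ! p))}"

locale container =
  fixes m n :: nat and lam :: "nat list" and sigma :: "nat set list"
  assumes in_OP: "sigma \<in> OP_from m n lam"
begin

lemma length_sigma: "length sigma = length lam"
  and blocks_Un: "(\<Union>p<length lam. sigma ! p) = {m..n}"
  and card_block: "p < length lam \<Longrightarrow> lam ! p \<le> card (sigma ! p)"
  using in_OP by (auto simp: OP_from_def)

lemma block_unique:
  "p < length lam \<Longrightarrow> q < length lam \<Longrightarrow> x \<in> sigma ! p \<Longrightarrow> x \<in> sigma ! q \<Longrightarrow> p = q"
  using in_OP unfolding OP_from_def by (metis (mono_tags, lifting) IntI empty_iff mem_Collect_eq)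

lemma block_subset: "p < length lam \<Longrightarrow> sigma ! p \<subseteq> {m..n}"
  using blocks_Un by blast

lemma finite_block: "p < length lam \<Longrightarrow> finite (sigma ! p)"
  using block_subset by (meson finite_atLeastAtMost finite_subset)

lemma block_of_eq: "p < length lam \<Longrightarrow> x \<in> sigma ! p \<Longrightarrow> block_of sigma x = p"
  unfolding block_of_def length_sigma using block_unique by blast

lemma box_entry_in_block:
  assumes "p < length lam" "1 \<le> r" "r \<le> lam ! p"
  shows "box_entry lam sigma p r \<in> sigma ! p"
proof -
  have "lam ! p - r < length (sorted_list_of_set (sigma ! p))"
    using assms card_block[of p] by simp
  then show ?thesis
    unfolding box_entry_def using finite_block[OF assms(1)] by (metis nth_mem set_sorted_list_of_set)
qed

text \<open>Blocks are disjoint and their increasing enumerations have no repetitions.\<close>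

lemma box_entry_inject:
  assumes "p < length lam" "1 \<le> r" "r \<le> lam ! p" "q < length lam" "1 \<le> r'" "r' \<le> lam ! q"
    and eq: "box_entry lam sigma p r = box_entry lam sigma q r'"
  shows "p = q \<and> r = r'"
proof -
  have pq: "p = q"
    using box_entry_in_block[OF assms(1-3)] box_entry_in_block[OF assms(4-6)] eq assms block_unique by metis
  have "lam ! p - r = lam ! p - r'"
    using eq assms card_block[of p] unfolding box_entry_def pq
    by (subst (asm) nth_eq_iff_index_eq) auto
  with pq assms show ?thesis by simp
qed

lemma in_row_iff: "in_row lam sigma r x \<longleftrightarrow>
    (\<exists>p<length lam. 1 \<le> r \<and> r \<le> lam ! p \<and> x = box_entry lam sigma p r)"
  by (simp add: in_row_def length_sigma)

lemma block_of_box_entry: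
  "p < length lam \<Longrightarrow> 1 \<le> r \<Longrightarrow> r \<le> lam ! p \<Longrightarrow> block_of sigma (box_entry lam sigma p r) = p"
  using block_of_eq box_entry_in_block by blast

end

section \<open>Removing the smallest element\<close>

locale container_min = container +
  fixes p :: nat
  assumes p: "p < length lam" and min_in: "m \<in> sigma ! p"
begin

abbreviation "lam' \<equiv> decrement lam p"
abbreviation "sigma' \<equiv> sigma[p := sigma ! p - {m}]"

lemma m_le_n: "m \<le> n"
  using block_subset[OF p] min_in by auto

lemma sorted_block: "sorted_list_of_set (sigma ! p) = m # sorted_list_of_set (sigma ! p - {m})"
proof -
  have "Min (sigma ! p) = m"
    using block_subset[OF p] min_in finite_block[OF p] by (intro Min_eqI) auto
  then show ?thesis
    using sorted_list_of_set_nonempty[of "sigma ! p"] min_in finite_block[OF p] by auto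
qed

text \<open>The index is 0, that of the minimum. For \<open>lam ! p = 0\<close> this is a formal
  value only, since rows start at 1.\<close>

lemma box_entry_bottom: "box_entry lam sigma p (lam ! p) = m"
  by (simp add: box_entry_def sorted_block)

lemma removed_in_OP: "sigma' \<in> OP_from (Suc m) n lam'"
proof -
  have nth: "sigma' ! q = sigma ! q - {m}" if "q < length lam" for q
    using block_unique[OF p that min_in] p length_sigma that by (cases "q = p") auto
  have "(\<Union>q<length lam. sigma' ! q) = (\<Union>q<length lam. sigma ! q) - {m}"
    using nth by auto
  also have "\<dots> = {Suc m..n}" unfolding blocks_Un by auto
  finally have "(\<Union>q<length sigma'. sigma' ! q) = {Suc m..n}" using length_sigma by simp
  moreover have "sigma' ! q \<inter> sigma' ! q' = {}"
    if "q < length lam" "q' < length lam" "q \<noteq> q'" for q q'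
    using block_unique[OF that(1,2)] that(3) nth[OF that(1)] nth[OF that(2)] by blast
  moreover have "lam' ! q \<le> card (sigma' ! q)" if "q < length lam" for q
    using card_block[OF that] card_block[OF p] length_sigma p min_in finite_block[OF p]
    by (cases "q = p") (auto simp: decrement_def)
  ultimately show ?thesis using length_sigma by (auto simp: OP_from_def decrement_def)
qed

sublocale removed: container "Suc m" n lam' sigma'
  by unfold_locales (rule removed_in_OP)

lemma length_lam': "length lam' = length lam"
  by (simp add: decrement_def)

lemma lam'_nth: "q < length lam \<Longrightarrow> lam' ! q = (if q = p then lam ! p - 1 else lam ! q)"
  by (simp add: decrement_def)

text \<open>Rows are numbered from the top, so losing the bottom box renumbers none: in column
  \<open>p\<close> the index drops by one and the enumeration loses its head.\<close>

lemma box_entry_removed: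
  assumes "q < length lam" "1 \<le> r" "r \<le> lam' ! q"
  shows "box_entry lam' sigma' q r = box_entry lam sigma q r"
proof (cases "q = p")
  case True
  with assms have "lam ! p - r = Suc (lam ! p - 1 - r)" by (auto simp: lam'_nth)
  with True p show ?thesis
    by (simp add: box_entry_def lam'_nth sorted_block length_sigma)
next
  case False
  with assms show ?thesis by (simp add: box_entry_def lam'_nth)
qed

lemma in_row_removed:
  assumes "x \<noteq> m"
  shows "in_row lam' sigma' r x \<longleftrightarrow> in_row lam sigma r x"
proof
  assume "in_row lam' sigma' r x"
  then obtain q where q: "q < length lam" "1 \<le> r" "r \<le> lam' ! q" "x = box_entry lam' sigma' q r"
    unfolding removed.in_row_iff length_lam' by blast
  with box_entry_removed[OF q(1-3)] show "in_row lam sigma r x"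
    unfolding in_row_iff by (auto simp: lam'_nth split: if_splits)
next
  assume "in_row lam sigma r x"
  then obtain q where q: "q < length lam" "1 \<le> r" "r \<le> lam ! q" "x = box_entry lam sigma q r"
    unfolding in_row_iff by blast
  \<comment> \<open>The only box missing from the smaller container is the one that held
    \<open>m\<close>.\<close>
  have "\<not> (q = p \<and> r = lam ! p)" using q(4) box_entry_bottom assms by metis
  with q have "r \<le> lam' ! q" by (auto simp: lam'_nth)
  with q show "in_row lam' sigma' r x"
    unfolding removed.in_row_iff length_lam' using box_entry_removed by metis
qed

lemma mem_block_removed: "x \<noteq> m \<Longrightarrow> x \<in> sigma' ! q \<longleftrightarrow> x \<in> sigma ! q"
  using p by (cases "q = p") (auto simp: length_sigma)

lemma block_of_removed: "x \<noteq> m \<Longrightarrow> block_of sigma' x = block_of sigma x"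
  by (simp add: block_of_def mem_block_removed)

lemma floating_removed: "x \<noteq> m \<Longrightarrow> floating lam' sigma' x \<longleftrightarrow> floating lam sigma x"
  by (simp add: floating_def mem_block_removed in_row_removed)

text \<open>A coinversion has \<open>i < j\<close>, so neither entry is \<open>m\<close>, and all
  other elements keep row, block and floating status.\<close>

lemma coinversion_removed:
  assumes "m < i"
  shows "coinversion lam' sigma' i j \<longleftrightarrow> coinversion lam sigma i j"
proof (cases "i < j")
  case True
  with assms show ?thesis
    by (simp add: coinversion_def in_row_removed block_of_removed floating_removed)
qed (simp add: coinversion_def)

lemma code_entry_removed: "m < i \<Longrightarrow> code_entry n lam' sigma' i = code_entry n lam sigma i"
  by (simp add: code_entry_def coinversion_removed floating_removed block_of_removed)

lemma in_row_min_iff: "in_row lam sigma r m \<longleftrightarrow> 1 \<le> r \<and> r = lam ! p"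
proof
  assume "in_row lam sigma r m"
  then obtain q where q: "q < length lam" "1 \<le> r" "r \<le> lam ! q" "m = box_entry lam sigma q r"
    unfolding in_row_iff by blast
  then have "q = p" using box_entry_in_block block_unique p min_in by metis
  with q have "1 \<le> lam ! p" "r \<le> lam ! p" by auto
  with q box_entry_inject[OF q(1-3) p, of "lam ! p"] box_entry_bottom
  show "1 \<le> r \<and> r = lam ! p" by auto
next
  assume "1 \<le> r \<and> r = lam ! p"
  with p show "in_row lam sigma r m"
    unfolding in_row_iff by (intro exI[of _ p]) (simp add: box_entry_bottom)
qed

lemma box_entry_greater:
  assumes "q < length lam" "1 \<le> r" "r \<le> lam ! q" "q \<noteq> p"
  shows "m < box_entry lam sigma q r" and "box_entry lam sigma q r \<le> n"
proof -
  have "box_entry lam sigma q r \<in> sigma ! q" using assms by (intro box_entry_in_block) auto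
  moreover have "m \<notin> sigma ! q" using block_unique[OF assms(1) p _ min_in] assms(4) by blast
  ultimately show "m < box_entry lam sigma q r" "box_entry lam sigma q r \<le> n"
    using block_subset[OF assms(1)] by (auto simp: le_less)
qed

text \<open>As \<open>m\<close> is minimal, only the positions of boxes matter. Each block preceding
  \<open>p\<close> contributes exactly one, by a coinversion with \<open>m\<close> or, if
  \<open>m\<close> floats, possibly through the summand \<open>block_of sigma m\<close>.\<close>

lemma code_entry_min: "code_entry n lam sigma m = block_rank lam p"
proof (cases "lam ! p")
  case (Suc a)
  \<comment> \<open>The row in which block \<open>q\<close> forms a coinversion with
    \<open>m\<close>: the row of \<open>m\<close> for \<open>q\<close> on the right, the one below
    for \<open>q\<close> on the left. \<open>precedes\<close> says exactly that column
    \<open>q\<close> reaches it.\<close>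
  let ?r = "\<lambda>q. if p < q then Suc a else Suc (Suc a)"
  let ?Q = "{q. q < length lam \<and> precedes lam q p}"
  have r: "q \<noteq> p" "1 \<le> ?r q" "?r q \<le> lam ! q" if "q \<in> ?Q" for q
    using that Suc by (auto simp: precedes_def split: if_splits)
  have min_row: "in_row lam sigma r m \<longleftrightarrow> r = Suc a" for r
    using Suc by (auto simp: in_row_min_iff)
  have not_floating: "\<not> floating lam sigma m"
    by (auto simp: floating_def min_row)
  have "{j \<in> {1..n}. coinversion lam sigma m j} = (\<lambda>q. box_entry lam sigma q (?r q)) ` ?Q"
  proof (intro equalityI subsetI)
    fix j assume "j \<in> {j \<in> {1..n}. coinversion lam sigma m j}"
    then consider "in_row lam sigma (Suc a) j" "p < block_of sigma j"
      | "in_row lam sigma (Suc (Suc a)) j" "block_of sigma j < p"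
      by (auto simp: coinversion_def not_floating min_row block_of_eq[OF p min_in])
    then show "j \<in> (\<lambda>q. box_entry lam sigma q (?r q)) ` ?Q"
    proof cases
      case 1
      then obtain q where q: "q < length lam" "Suc a \<le> lam ! q" "j = box_entry lam sigma q (Suc a)"
        unfolding in_row_iff by blast
      with 1 have "p < q" using block_of_box_entry[of q "Suc a"] by simp
      with q Suc show ?thesis by (intro image_eqI[of _ _ q]) (auto simp: precedes_def)
    next
      case 2
      then obtain q where q: "q < length lam" "Suc (Suc a) \<le> lam ! q"
          "j = box_entry lam sigma q (Suc (Suc a))"
        unfolding in_row_iff by blast
      with 2 have "q < p" using block_of_box_entry[of q "Suc (Suc a)"] by simp
      with q Suc show ?thesis by (intro image_eqI[of _ _ q]) (auto simp: precedes_def)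
    qed
  next
    fix j assume "j \<in> (\<lambda>q. box_entry lam sigma q (?r q)) ` ?Q"
    then obtain q where q: "q \<in> ?Q" and j: "j = box_entry lam sigma q (?r q)" by blast
    have ql: "q < length lam" using q by simp
    have "in_row lam sigma (?r q) j" unfolding in_row_iff j using r[OF q] ql by blast
    moreover have "block_of sigma j = q" unfolding j by (rule block_of_box_entry[OF ql r(2,3)[OF q]])
    moreover have "m < j" "j \<le> n" unfolding j by (rule box_entry_greater[OF ql r(2,3,1)[OF q]])+
    ultimately show "j \<in> {j \<in> {1..n}. coinversion lam sigma m j}"
      using r(1)[OF q]
      by (auto simp: coinversion_def min_row block_of_eq[OF p min_in] split: if_splits)
  qed
  moreover have "inj_on (\<lambda>q. box_entry lam sigma q (?r q)) ?Q"
  proof (rule inj_onI)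
    fix q q' assume q: "q \<in> ?Q" "q' \<in> ?Q"
      and eq: "box_entry lam sigma q (?r q) = box_entry lam sigma q' (?r q')"
    show "q = q'" using box_entry_inject[OF _ r(2,3)[OF q(1)] _ r(2,3)[OF q(2)] eq] q by simp
  qed
  ultimately show ?thesis
    by (simp add: code_entry_def block_rank_def not_floating card_image)
next
  case 0
  let ?Q = "{q. q < length lam \<and> p < q \<and> 1 \<le> lam ! q}"
  have min_row: "\<not> in_row lam sigma r m" for r
    using 0 by (auto simp: in_row_min_iff)
  have floating: "floating lam sigma m"
    using p min_in by (auto simp: floating_def min_row length_sigma)
  have "{j \<in> {1..n}. coinversion lam sigma m j} = (\<lambda>q. box_entry lam sigma q 1) ` ?Q"
  proof (intro equalityI subsetI)
    fix j assume "j \<in> {j \<in> {1..n}. coinversion lam sigma m j}"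
    then have j: "in_row lam sigma 1 j" "p < block_of sigma j"
      by (auto simp: coinversion_def min_row block_of_eq[OF p min_in])
    then obtain q where q: "q < length lam" "1 \<le> lam ! q" "j = box_entry lam sigma q 1"
      unfolding in_row_iff by blast
    with j have "p < q" using block_of_box_entry[of q 1] by simp
    with q show "j \<in> (\<lambda>q. box_entry lam sigma q 1) ` ?Q" by blast
  next
    fix j assume "j \<in> (\<lambda>q. box_entry lam sigma q 1) ` ?Q"
    then obtain q where q: "q < length lam" "p < q" "1 \<le> lam ! q" "j = box_entry lam sigma q 1"
      by blast
    have "in_row lam sigma 1 j" unfolding in_row_iff using q by blast
    moreover have "block_of sigma j = q" using q block_of_box_entry[of q 1] by simp
    moreover have "m < j" "j \<le> n" using q box_entry_greater[of q 1] by auto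
    ultimately show "j \<in> {j \<in> {1..n}. coinversion lam sigma m j}"
      using q by (auto simp: coinversion_def floating block_of_eq[OF p min_in])
  qed
  moreover have "inj_on (\<lambda>q. box_entry lam sigma q 1) ?Q"
    by (rule inj_onI) (use box_entry_inject in auto)
  \<comment> \<open>At height 0 every block on the left precedes \<open>p\<close>, whatever its
    height, while one on the right does so only if it has boxes.\<close>
  moreover have "block_rank lam p = card (?Q \<union> {..<p})"
    unfolding block_rank_def using 0 p
    by (intro arg_cong[where f = card]) (auto simp: precedes_def, metis less_irrefl linorder_neqE_nat)
  moreover have "card (?Q \<union> {..<p}) = card ?Q + p"
    by (subst card_Un_disjoint) auto
  ultimately show ?thesis
    by (simp add: code_entry_def floating block_of_eq[OF p min_in] card_image)
qed

end

section \<open>Recursion for the code\<close>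

text \<open>This inverts the removal: the element gained by block \<open>p\<close> pays for
  restoring its lower bound.\<close>

lemma insert_min_in_OP:
  assumes tau: "tau \<in> OP_from (Suc m) n (decrement lam p)" and p: "p < length lam" and "m \<le> n"
  shows "tau[p := insert m (tau ! p)] \<in> OP_from m n lam"
    and "m \<notin> tau ! p"
proof -
  interpret tau: container "Suc m" n "decrement lam p" tau
    by unfold_locales (rule tau)
  let ?sigma = "tau[p := insert m (tau ! p)]"
  have len: "length tau = length lam" using tau.length_sigma by (simp add: decrement_def)
  have notin: "m \<notin> tau ! q" if "q < length lam" for q
    using tau.block_subset[of q] that by (auto simp: decrement_def)
  then show "m \<notin> tau ! p" using p by blast
  have nth: "?sigma ! q = (if q = p then insert m (tau ! p) else tau ! q)" if "q < length lam" for q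
    using that len by simp
  have "(\<Union>q<length lam. ?sigma ! q) = insert m (\<Union>q<length lam. tau ! q)"
    using p nth by (auto split: if_splits)
  also have "\<dots> = {m..n}"
    using tau.blocks_Un \<open>m \<le> n\<close> by (auto simp: decrement_def)
  finally have "(\<Union>q<length lam. ?sigma ! q) = {m..n}" .
  moreover have "?sigma ! q \<inter> ?sigma ! q' = {}"
    if "q < length lam" "q' < length lam" "q \<noteq> q'" for q q'
    using tau.block_unique[of q q'] that notin[OF that(1)] notin[OF that(2)]
    by (auto simp: nth decrement_def)
  moreover have "lam ! q \<le> card (?sigma ! q)" if "q < length lam" for q
    using tau.card_block[of q] tau.finite_block[of q] that notin[OF that]
    by (auto simp: nth decrement_def)
  ultimately show "?sigma \<in> OP_from m n lam"
    using len by (simp add: OP_from_def)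
qed

text \<open>\<open>code_entry\<close> still counts over \<open>{1..n}\<close>; this adds nothing
  below \<open>m\<close>, as a coinversion \<open>(i, j)\<close> has
  \<open>j > i \<ge> m\<close>.\<close>

definition code_from :: "nat \<Rightarrow> nat \<Rightarrow> nat list \<Rightarrow> nat set list \<Rightarrow> nat list" where
  "code_from m n lam sigma = map (code_entry n lam sigma) [m..<Suc n]"

lemma code_from_remove:
  assumes "sigma \<in> OP_from m n lam" "p < length lam" "m \<in> sigma ! p"
  defines "tau \<equiv> sigma[p := sigma ! p - {m}]"
  shows "tau \<in> OP_from (Suc m) n (decrement lam p)"
    and "code_from m n lam sigma = block_rank lam p # code_from (Suc m) n (decrement lam p) tau"
proof -
  interpret container_min m n lam sigma p
    using assms by unfold_locales
  show "tau \<in> OP_from (Suc m) n (decrement lam p)" unfolding tau_def by (rule removed_in_OP)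
  have "[m..<Suc n] = m # [Suc m..<Suc n]" using m_le_n by (simp add: upt_conv_Cons)
  then show "code_from m n lam sigma = block_rank lam p # code_from (Suc m) n (decrement lam p) tau"
    unfolding code_from_def tau_def by (simp add: code_entry_min code_entry_removed del: upt_Suc)
qed

lemma min_in_some_block:
  assumes "sigma \<in> OP_from m n lam" "m \<le> n"
  obtains p where "p < length lam" "m \<in> sigma ! p"
proof -
  interpret container m n lam sigma by unfold_locales (rule assms(1))
  have "m \<in> (\<Union>p<length lam. sigma ! p)" unfolding blocks_Un using assms(2) by simp
  with that show ?thesis by blast
qed

lemma code_from_Cons_iff:
  assumes "m \<le> n"
  shows "(\<exists>sigma\<in>OP_from m n lam. code_from m n lam sigma = x # c) \<longleftrightarrow>
    (\<exists>p<length lam. block_rank lam p = x \<and>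
       (\<exists>tau\<in>OP_from (Suc m) n (decrement lam p). code_from (Suc m) n (decrement lam p) tau = c))"
proof
  assume "\<exists>sigma\<in>OP_from m n lam. code_from m n lam sigma = x # c"
  then obtain sigma where s: "sigma \<in> OP_from m n lam" "code_from m n lam sigma = x # c" by blast
  obtain p where p: "p < length lam" "m \<in> sigma ! p" using min_in_some_block[OF s(1) assms] .
  from code_from_remove[OF s(1) p] s p
  show "\<exists>p<length lam. block_rank lam p = x \<and>
       (\<exists>tau\<in>OP_from (Suc m) n (decrement lam p). code_from (Suc m) n (decrement lam p) tau = c)"
    by auto
next
  assume "\<exists>p<length lam. block_rank lam p = x \<and>
       (\<exists>tau\<in>OP_from (Suc m) n (decrement lam p). code_from (Suc m) n (decrement lam p) tau = c)"
  then obtain p tau where p: "p < length lam" "block_rank lam p = x"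
    and tau: "tau \<in> OP_from (Suc m) n (decrement lam p)" "code_from (Suc m) n (decrement lam p) tau = c"
    by blast
  let ?sigma = "tau[p := insert m (tau ! p)]"
  note ins = insert_min_in_OP[OF tau(1) p(1) assms]
  have "length tau = length lam" using tau(1) by (simp add: OP_from_def decrement_def)
  \<comment> \<open>Deleting the inserted \<open>m\<close> gives back \<open>tau\<close> because
    \<open>m\<close> was not in it before.\<close>
  with p(1) ins(2) have "m \<in> ?sigma ! p" "?sigma[p := ?sigma ! p - {m}] = tau" by auto
  with code_from_remove(2)[OF ins(1) p(1)] p tau ins(1)
  show "\<exists>sigma\<in>OP_from m n lam. code_from m n lam sigma = x # c" by auto
qed

section \<open>Injectivity\<close>

text \<open>Equal first letters are equal ranks, hence \<open>m\<close> lies in the same block;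
  induction handles the rest, with \<open>lam\<close> varying.\<close>

lemma inj_on_code_from: "inj_on (code_from m n lam) (OP_from m n lam)"
proof (induction "Suc n - m" arbitrary: m lam)
  case 0
  show ?case
  proof (rule inj_onI)
    fix sigma tau assume "sigma \<in> OP_from m n lam" "tau \<in> OP_from m n lam"
    with 0 have "length sigma = length tau" "\<forall>p<length sigma. sigma ! p = {}" "\<forall>p<length tau. tau ! p = {}"
      by (auto simp: OP_from_def)
    then show "sigma = tau" by (intro nth_equalityI) auto
  qed
next
  case (Suc d)
  then have "m \<le> n" by simp
  show ?case
  proof (rule inj_onI)
    fix sigma tau assume s: "sigma \<in> OP_from m n lam" and t: "tau \<in> OP_from m n lam"
      and eq: "code_from m n lam sigma = code_from m n lam tau"
    obtain p where p: "p < length lam" "m \<in> sigma ! p" using min_in_some_block[OF s \<open>m \<le> n\<close>] .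
    obtain q where q: "q < length lam" "m \<in> tau ! q" using min_in_some_block[OF t \<open>m \<le> n\<close>] .
    note rs = code_from_remove[OF s p] and rt = code_from_remove[OF t q]
    have "block_rank lam p = block_rank lam q" using eq rs(2) rt(2) by simp
    then have pq: "q = p" using inj_on_block_rank p q by (auto dest: inj_onD)
    have "sigma[p := sigma ! p - {m}] = tau[p := tau ! p - {m}]"
    proof (rule inj_onD)
      show "inj_on (code_from (Suc m) n (decrement lam p)) (OP_from (Suc m) n (decrement lam p))"
        using Suc by simp
    qed (use eq rs rt pq in simp_all)
    \<comment> \<open>Putting \<open>m\<close> back undoes its removal.\<close>
    moreover have "rho[p := rho ! p - {m}, p := insert m (rho[p := rho ! p - {m}] ! p)] = rho"
      if "rho \<in> OP_from m n lam" "m \<in> rho ! p" for rho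
      using that p(1) by (simp add: OP_from_def insert_absorb)
    ultimately show "sigma = tau" using s t p q unfolding pq by metis
  qed
qed

section \<open>The image of the code\<close>

text \<open>The conjunct \<open>sum_list lam \<le> Suc n - m\<close> guards the truncated difference
  in the last argument, which would read 0 when there are too few elements.\<close>

lemma code_from_dominated_iff:
  assumes "length lam = Suc t" "\<forall>a\<in>set lam. a \<le> K"
  shows "(\<exists>sigma\<in>OP_from m n lam. code_from m n lam sigma = c) \<longleftrightarrow>
    length c = Suc n - m \<and> sum_list lam \<le> Suc n - m
    \<and> dominated t c (conj_mset K lam) (Suc n - m - sum_list lam)"
  using assms
proof (induction "Suc n - m" arbitrary: m lam c)
  case 0
  then have m: "n < m" by simp
  show ?case
  proof
    assume "\<exists>sigma\<in>OP_from m n lam. code_from m n lam sigma = c"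
    then obtain sigma where s: "sigma \<in> OP_from m n lam" "code_from m n lam sigma = c" by blast
    \<comment> \<open>The ground set is empty, so the size bound forces every part to be 0.\<close>
    then have "lam ! p = 0" if "p < length lam" for p
      using m that by (fastforce simp: OP_from_def)
    note z0 = this
    then have z: "\<forall>a\<in>set lam. a = 0" by (metis in_set_conv_nth)
    have "conj_part lam j = 0" if "1 \<le> j" for j
      using z0 that by (auto simp: conj_part_def)
    then have "\<forall>u\<in>#conj_mset K lam. u = 0" by (auto simp: conj_mset_def)
    with s m z show "length c = Suc n - m \<and> sum_list lam \<le> Suc n - m
        \<and> dominated t c (conj_mset K lam) (Suc n - m - sum_list lam)"
      by (auto simp: code_from_def)
  next
    assume "length c = Suc n - m \<and> sum_list lam \<le> Suc n - m
        \<and> dominated t c (conj_mset K lam) (Suc n - m - sum_list lam)"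
    with m have "c = []" "\<forall>a\<in>set lam. a = 0" by auto
    then have "replicate (length lam) {} \<in> OP_from m n lam" "code_from m n lam (replicate (length lam) {}) = c"
      using m by (auto simp: OP_from_def code_from_def)
    then show "\<exists>sigma\<in>OP_from m n lam. code_from m n lam sigma = c" by blast
  qed
next
  case (Suc d)
  then have mn: "m \<le> n" by simp
  show ?case
  proof (cases c)
    case Nil
    with mn show ?thesis by (auto simp: code_from_def)
  next
    case (Cons x c')
    have IH: "(\<exists>tau\<in>OP_from (Suc m) n (decrement lam p). code_from (Suc m) n (decrement lam p) tau = c') \<longleftrightarrow>
      length c' = n - m \<and> sum_list (decrement lam p) \<le> n - m
      \<and> dominated t c' (conj_mset K (decrement lam p)) (n - m - sum_list (decrement lam p))" for p
    proof -
      have "\<forall>a\<in>set (decrement lam p). a \<le> K"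
      proof
        fix a assume "a \<in> set (decrement lam p)"
        then obtain q where "q < length lam" "a = decrement lam p ! q"
          by (auto simp: in_set_conv_nth decrement_def)
        then have "a \<le> lam ! q" "lam ! q \<in> set lam" by (cases "q = p"; simp add: decrement_def)+
        with Suc.prems(2) show "a \<le> K" by fastforce
      qed
      moreover have "length (decrement lam p) = Suc t" "d = Suc n - Suc m"
        using Suc.prems(1) Suc(2) by (auto simp: decrement_def)
      ultimately show ?thesis using Suc(1)[of "Suc m" "decrement lam p" c'] by simp
    qed
    show ?thesis
    proof (cases "x < length lam")
      \<comment> \<open>Both sides fail: ranks and dominated letters alike are below
        \<open>length lam\<close>.\<close>
      case False
      moreover have "block_rank lam p < length lam" if "p < length lam" for p
        using bij_betw_block_rank that by (auto simp: bij_betw_def)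
      ultimately have "\<not> (\<exists>p<length lam. block_rank lam p = x)" by blast
      moreover have "\<not> dominated t (x # c') (conj_mset K lam) N" for N
        using False dominated_Cons_imp_less Suc.prems(1) by blast
      ultimately show ?thesis unfolding Cons code_from_Cons_iff[OF mn] by blast
    next
      case True
      then have "x \<in> block_rank lam ` {..<length lam}"
        using bij_betw_block_rank by (simp add: bij_betw_def)
      then obtain p where p: "p < length lam" "x = block_rank lam p" by auto
      have "q = p" if "q < length lam" "block_rank lam q = x" for q
        using inj_onD[OF inj_on_block_rank, of lam q p] that p by simp
      \<comment> \<open>Injectivity of the rank leaves one candidate for the block of
        \<open>m\<close>.\<close>
      then have only: "(\<exists>q<length lam. block_rank lam q = x \<and> P q) \<longleftrightarrow> P p" for P
        using p by metis
      have "(\<exists>sigma\<in>OP_from m n lam. code_from m n lam sigma = x # c') \<longleftrightarrow>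
        length c' = n - m \<and> sum_list (decrement lam p) \<le> n - m
        \<and> dominated t c' (conj_mset K (decrement lam p)) (n - m - sum_list (decrement lam p))"
        unfolding code_from_Cons_iff[OF mn] only IH by (rule refl)
      also have "\<dots> \<longleftrightarrow> length c' = n - m \<and> sum_list lam \<le> Suc n - m
        \<and> dominated t (x # c') (conj_mset K lam) (Suc n - m - sum_list lam)"
      proof (cases "lam ! p")
        case (Suc a)
        have in_set: "lam ! p \<in> set lam" using p by simp
        then have "Suc a \<le> K" "Suc a \<le> sum_list lam"
          using Suc.prems(2) Suc member_le_sum_list[OF in_set] by auto
        \<comment> \<open>The sum drops together with the number of elements, so the number of
          constant entries is unchanged.\<close>
        moreover have "sum_list (decrement lam p) = sum_list lam - 1"
          unfolding decrement_def using p Suc member_le_sum_list[OF in_set]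
          by (simp add: sum_list_update)
        ultimately show ?thesis
          using dominated_Cons_positive[OF p(1) Suc] Suc.prems(1) p mn
          by (auto simp: Suc_diff_le)
      next
        case 0
        have "decrement lam p = lam" using 0 by (simp add: decrement_def) (metis 0 list_update_id)
        \<comment> \<open>A constant entry is left exactly when the remaining elements still suffice
          for the unchanged \<open>lam\<close>.\<close>
        moreover have "Suc n - m - sum_list lam = Suc N'
            \<longleftrightarrow> sum_list lam \<le> n - m \<and> N' = n - m - sum_list lam" for N'
          using mn by auto
        ultimately show ?thesis
          unfolding p(2) dominated_Cons_zero[OF p(1) 0 Suc.prems(1)] by auto
      qed
      finally show ?thesis using mn unfolding Cons by (simp add: Suc_diff_le)
    qed
  qed
qed

text \<open>The bound \<open>K\<close> starts at \<open>sum_list lam\<close>, the last index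
  \<open>j\<close> used by \<open>code_shuffles\<close>.\<close>

lemma C_seqs_iff:
  "c \<in> C_seqs n lam \<longleftrightarrow> length c = n \<and>
     dominated (length lam - 1) c (conj_mset (sum_list lam) lam) (n - sum_list lam)"
proof -
  have "mset (map (conj_part lam) [1..<sum_list lam + 1]) = conj_mset (sum_list lam) lam"
    by (simp add: conj_mset_def atLeastLessThanSuc_atLeastAtMost del: upt_Suc)
  with multi_shuffles_dominated_iff[of "map (conj_part lam) [1..<sum_list lam + 1]"
      "n - sum_list lam" "length lam - 1" c]
  show ?thesis
    by (simp add: C_seqs_def code_shuffles_def Let_def comp_def del: upt_Suc)
qed

theorem theorem3p6:
  fixes n k s :: nat and lam :: "nat list"
  assumes "0 < k" and "k \<le> n" and "is_partition k s lam"
  shows "bij_betw (coinv_code n lam) (OP n lam) (C_seqs n lam)"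
proof -
  have k: "sum_list lam = k" using assms(3) by (simp add: is_partition_def)
  \<comment> \<open>A positive sum excludes the empty list, so \<open>s - 1\<close> is not
    truncated.\<close>
  with assms(1) obtain t where t: "length lam = Suc t" by (cases lam) auto
  have K: "\<forall>a\<in>set lam. a \<le> sum_list lam" by (simp add: member_le_sum_list)
  have OP: "OP n lam = OP_from 1 n lam" by (simp add: OP_def OP_from_def)
  have code: "coinv_code n lam = code_from 1 n lam"
    by (simp add: coinv_code_def code_from_def fun_eq_iff)
  have "c \<in> code_from 1 n lam ` OP_from 1 n lam \<longleftrightarrow> c \<in> C_seqs n lam" for c
  proof -
    have "c \<in> code_from 1 n lam ` OP_from 1 n lam \<longleftrightarrow>
        (\<exists>sigma\<in>OP_from 1 n lam. code_from 1 n lam sigma = c)" by blast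
    with code_from_dominated_iff[OF t K, of 1 n c] assms(2) k t show ?thesis
      by (simp add: C_seqs_iff)
  qed
  with inj_on_code_from show ?thesis
    unfolding OP code bij_betw_def by blast
qed

end
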